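(* Let $\mathbb T$ be a time scale and consider a system $x^\Delta=F(t,x)$, $t\in\mathbb T_0^+$, $x\in\mathbb R^n$, with $F(t,0)\equiv0$. If there is a Chetaev function for this system, then the zero solution of the system is unstable.
   Context: A time scale $\mathbb T$ is an unbounded closed subset of $\mathbb R$ with $0\in\mathbb T$; $\mathbb T_a^+=[a,\infty)\cap\mathbb T$. Forward jump: $\sigma(t)=\inf\{s\in\mathbb T: s>t\}$; graininess: $\mu(t)=\sigma(t)-t$. $\mathbb S=\{t\in\mathbb T:\sigma(t)>t\}$ is the set of right-scattered points, $\mathbb D=\{t\in\mathbb T:\sigma(t)=t\}$ the set of right-dense points. It is always assumed that $\sup\mathbb S=+\infty$. $B_r$ is the Euclidean ball of radius $r$ centred at $0$ in $\mathbb R^n$. $f^\Delta(t)=\gamma$ means: for every $\epsilon>0$ there is a neighbourhood $W$ of $t$ with $|f(\sigma(t))-f(s)-\gamma(\sigma(t)-s)|\le\epsilon|\sigma(t)-s|$ for all $s\in W\cap\mathbb T$. It is implicit that $F$ is regular enough for initial value problems to be uniquely solvable forward in time as long as the solution stays in the region considered. Let $r>0$. A continuous function $V:\mathbb T_0^+\times B_r\to\mathbb R$ is a Chetaev function for the system if for some $a>0$ and for all $t\in\mathbb T_a^+$: 1. $0\in\partial\Omega_t$ (boundary), where $\Omega_t=\{x\in B_r: V(t,x)>0\}$; 2. $V$ is continuous at the origin $x=0$ uniformly with respect to $t$; 3. the trajectory $\Delta$-derivative of $V$ satisfies $V^\Delta(t,x)\ge w(x)$ for $x\in\Omega_t$,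 where $w$ is a positive definite function (continuous, $w(0)=0$, $w(x)>0$ for $x\neq0$) not depending on $t$. Here the trajectory $\Delta$-derivative $V^\Delta(t,x)$ is the $\Delta$-derivative at time $t$ of $s\mapsto V(s,x(s))$ along the solution with $x(t)=x$; that is, condition 3 means $$\frac{\partial V}{\partial t}(t,x)+\frac{\partial V}{\partial x}(t,x)\cdot F(t,x)\ge w(x)\quad\text{for } t\in\mathbb T_a^+\cap\mathbb D,\ x\in\Omega_t,$$ $$V(\sigma(t),x+\mu(t)F(t,x))-V(t,x)\ge\mu(t)w(x)\quad\text{for } t\in\mathbb T_a^+\cap\mathbb S,\ x\in\Omega_t$$ (the latter whenever $x+\mu(t)F(t,x)\in B_r$, so that the left-hand side is defined). The zero solution is stable if for every $t_0\in\mathbb T_0^+$ and $\epsilon>0$ there is $\delta>0$ such that $|x_0|<\delta$ implies that the solution with $x(t_0)=x_0$ exists and satisfies $|x(t)|<\epsilon$ for all $t\in\mathbb T_{t_0}^+$; it is unstable if it is not stable. *)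

theory Defs
  imports "HOL-Analysis.Analysis"
begin

definition time_scale :: "real set \<Rightarrow> bool" where
  "time_scale T \<longleftrightarrow> closed T \<and> \<not> bounded T \<and> 0 \<in> T"

definition forward_jump :: "real set \<Rightarrow> real \<Rightarrow> real" where
  "forward_jump T t = Inf {s \<in> T. s > t}"

definition graininess :: "real set \<Rightarrow> real \<Rightarrow> real" where
  "graininess T t = forward_jump T t - t"

definition right_scattered :: "real set \<Rightarrow> real set" where
  "right_scattered T = {t \<in> T. forward_jump T t > t}"

definition right_dense :: "real set \<Rightarrow> real set" where
  "right_dense T = {t \<in> T. forward_jump T t = t}"

definition has_delta_derivative ::
  "real set \<Rightarrow> (real \<Rightarrow> 'a::real_normed_vector) \<Rightarrow> 'a \<Rightarrow> real \<Rightarrow> bool" where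
  "has_delta_derivative T f \<gamma> t \<longleftrightarrow>
     (\<forall>\<epsilon>>0. \<exists>W. open W \<and> t \<in> W \<and>
        (\<forall>s \<in> W \<inter> T.
           norm (f (forward_jump T t) - f s - (forward_jump T t - s) *\<^sub>R \<gamma>)
             \<le> \<epsilon> * \<bar>forward_jump T t - s\<bar>))"

text \<open>
  Solutions are considered on sets \<open>J\<close> of the form \<open>T \<inter> {t0..}\<close> or \<open>T \<inter> {t0..t1}\<close>
  with \<open>t1 \<in> T\<close>.  At a point of \<open>J\<close> that is not the last one, the forward jump taken
  in \<open>J\<close> is the one taken in \<open>T\<close> (lemma \<open>forward_jump_restrict\<close> below).  At the last
  point, if there is one, only continuity is required.
\<close>

definition solution_on ::
  "(real \<Rightarrow> 'a::real_normed_vector \<Rightarrow> 'a) \<Rightarrow> real set \<Rightarrow> (real \<Rightarrow> 'a) \<Rightarrow> bool" where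
  "solution_on F J x \<longleftrightarrow>
     continuous_on J x \<and>
     (\<forall>t \<in> J. (\<exists>s \<in> J. s > t) \<longrightarrow> has_delta_derivative J x (F t (x t)) t)"

text \<open>
  Unique solvability forward in time as long as the solution stays in the region \<open>G\<close>:
  from every initial point in \<open>G\<close> there is a solution which either stays in \<open>G\<close> for ever
  or exists up to a first time at which it is outside \<open>G\<close>, and two solutions agree as
  long as they are in \<open>G\<close>.
\<close>

definition uniquely_solvable_in ::
  "real set \<Rightarrow> (real \<Rightarrow> 'a::real_normed_vector \<Rightarrow> 'a) \<Rightarrow> 'a set \<Rightarrow> bool" where
  "uniquely_solvable_in T F G \<longleftrightarrow>
     (\<forall>t0 \<in> T \<inter> {0..}. \<forall>x0 \<in> G.
        (\<exists>x. solution_on F (T \<inter> {t0..}) x \<and> x t0 = x0 \<and> (\<forall>t \<in> T \<inter> {t0..}. x t \<in> G)) \<or>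
        (\<exists>t1 \<in> T. t0 < t1 \<and>
           (\<exists>x. solution_on F (T \<inter> {t0..t1}) x \<and> x t0 = x0 \<and>
                (\<forall>t \<in> T \<inter> {t0..<t1}. x t \<in> G) \<and> x t1 \<notin> G))) \<and>
     (\<forall>t0 \<in> T \<inter> {0..}. \<forall>t1 \<in> T. t0 < t1 \<longrightarrow>
        (\<forall>x y. solution_on F (T \<inter> {t0..t1}) x \<and> solution_on F (T \<inter> {t0..t1}) y \<and> x t0 = y t0 \<and>
               (\<forall>t \<in> T \<inter> {t0..<t1}. x t \<in> G \<and> y t \<in> G) \<longrightarrow>
               (\<forall>t \<in> T \<inter> {t0..t1}. x t = y t)))"

text \<open>
  \<open>\<gamma>\<close> is the delta-derivative at \<open>t\<close> of \<open>s \<mapsto> V s (y s)\<close> along the solution \<open>y\<close>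
  with \<open>y t = x\<close>.  Since \<open>V\<close> is only given on the ball \<open>B\<^sub>r\<close>, the solution is followed on an
  interval \<open>T \<inter> {t..t1}\<close> on which it stays in \<open>B\<^sub>r\<close>; if \<open>t\<close> is right-scattered and the
  solution jumps out of \<open>B\<^sub>r\<close>, nothing is required.
  The lemmas \<open>trajectory_derivative_scattered_iff\<close> and \<open>trajectory_derivative_dense_iff\<close>
  evaluate this notion explicitly.
\<close>

definition has_trajectory_derivative ::
  "real set \<Rightarrow> (real \<Rightarrow> 'a::real_normed_vector \<Rightarrow> 'a) \<Rightarrow> real \<Rightarrow> (real \<Rightarrow> 'a \<Rightarrow> real) \<Rightarrow>
     real \<Rightarrow> real \<Rightarrow> 'a \<Rightarrow> bool" where
  "has_trajectory_derivative T F r V \<gamma> t x \<longleftrightarrow>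
     (\<forall>t1 \<in> T. \<forall>y. t < t1 \<and> solution_on F (T \<inter> {t..t1}) y \<and> y t = x \<and>
          (\<forall>s \<in> T \<inter> {t..t1}. y s \<in> ball 0 r) \<longrightarrow>
        has_delta_derivative (T \<inter> {t..t1}) (\<lambda>s. V s (y s)) \<gamma> t)"

definition positivity_domain ::
  "real \<Rightarrow> (real \<Rightarrow> 'a::real_normed_vector \<Rightarrow> real) \<Rightarrow> real \<Rightarrow> 'a set" where
  "positivity_domain r V t = {x \<in> ball 0 r. V t x > 0}"

definition positive_definite_on :: "'a::real_normed_vector set \<Rightarrow> ('a \<Rightarrow> real) \<Rightarrow> bool" where
  "positive_definite_on B w \<longleftrightarrow> continuous_on B w \<and> w 0 = 0 \<and> (\<forall>x \<in> B. x \<noteq> 0 \<longrightarrow> w x > 0)"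

definition chetaev_function ::
  "real set \<Rightarrow> (real \<Rightarrow> 'a::real_normed_vector \<Rightarrow> 'a) \<Rightarrow> real \<Rightarrow> (real \<Rightarrow> 'a \<Rightarrow> real) \<Rightarrow> bool"
where
  "chetaev_function T F r V \<longleftrightarrow>
     continuous_on ((T \<inter> {0..}) \<times> ball 0 r) (\<lambda>(t, x). V t x) \<and>
     (\<exists>a>0.
        (\<forall>t \<in> T \<inter> {a..}. 0 \<in> frontier (positivity_domain r V t)) \<and>
        (\<forall>\<epsilon>>0. \<exists>\<delta>>0. \<forall>t \<in> T \<inter> {a..}. \<forall>x \<in> ball 0 r.
           norm x < \<delta> \<longrightarrow> \<bar>V t x - V t 0\<bar> < \<epsilon>) \<and>
        (\<exists>w. positive_definite_on (ball 0 r) w \<and>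
           (\<forall>t \<in> T \<inter> {a..}. \<forall>x \<in> positivity_domain r V t.
              \<exists>\<gamma>. has_trajectory_derivative T F r V \<gamma> t x \<and> \<gamma> \<ge> w x)))"

text \<open>The solution in question is unique wherever \<open>uniquely_solvable_in\<close> applies.\<close>

definition zero_solution_stable ::
  "real set \<Rightarrow> (real \<Rightarrow> 'a::real_normed_vector \<Rightarrow> 'a) \<Rightarrow> bool" where
  "zero_solution_stable T F \<longleftrightarrow>
     (\<forall>t0 \<in> T \<inter> {0..}. \<forall>\<epsilon>>0. \<exists>\<delta>>0. \<forall>x0. norm x0 < \<delta> \<longrightarrow>
        (\<exists>x. solution_on F (T \<inter> {t0..}) x \<and> x t0 = x0 \<and>
             (\<forall>t \<in> T \<inter> {t0..}. norm (x t) < \<epsilon>)))"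

abbreviation zero_solution_unstable ::
  "real set \<Rightarrow> (real \<Rightarrow> 'a::real_normed_vector \<Rightarrow> 'a) \<Rightarrow> bool" where
  "zero_solution_unstable T F \<equiv> \<not> zero_solution_stable T F"


subsection \<open>The trajectory derivative in explicit form\<close>

lemma forward_jump_restrict:
  assumes "t1 \<in> T" "t < t1" "T \<inter> {t..t1} \<subseteq> J" "J \<subseteq> T"
  shows "forward_jump J t = forward_jump T t"
proof -
  have t1J: "t1 \<in> {s \<in> J. s > t}" using assms by auto
  have bJ: "bdd_below {s \<in> J. s > t}" and bT: "bdd_below {s \<in> T. s > t}"
    by (auto intro!: bdd_belowI[of _ t])
  have "Inf {s \<in> T. s > t} \<le> Inf {s \<in> J. s > t}"
    by (rule cInf_superset_mono) (use t1J assms bT in auto)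
  moreover have "Inf {s \<in> J. s > t} \<le> Inf {s \<in> T. s > t}"
  proof (rule cInf_greatest)
    show "{s \<in> T. s > t} \<noteq> {}" using assms by auto
    fix s assume s: "s \<in> {s \<in> T. s > t}"
    show "Inf {s \<in> J. s > t} \<le> s"
    proof (cases "s \<le> t1")
      case True
      then have "s \<in> {s \<in> J. s > t}" using s assms by auto
      then show ?thesis by (rule cInf_lower[OF _ bJ])
    next
      case False
      have "Inf {s \<in> J. s > t} \<le> t1" by (rule cInf_lower[OF t1J bJ])
      then show ?thesis using False by simp
    qed
  qed
  ultimately show ?thesis by (simp add: forward_jump_def)
qed

lemma forward_jump_le: "s \<in> T \<Longrightarrow> t < s \<Longrightarrow> forward_jump T t \<le> s"
  unfolding forward_jump_def by (rule cInf_lower) (auto intro!: bdd_belowI[of _ t])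

lemma forward_jump_in:
  assumes "closed T" "t1 \<in> T" "t < t1"
  shows "forward_jump T t \<in> T"
proof -
  let ?A = "{s \<in> T. s > t}"
  have "Inf ?A \<in> closure ?A"
    by (rule closure_contains_Inf) (use assms in \<open>auto intro!: bdd_belowI[of _ t]\<close>)
  also have "closure ?A \<subseteq> T" by (rule closure_minimal) (use assms in auto)
  finally show ?thesis by (simp add: forward_jump_def)
qed

lemma has_delta_derivative_scattered:
  assumes J: "J \<subseteq> {t..}" "t \<in> J" and sc: "t < forward_jump J t"
  shows "has_delta_derivative J f \<gamma> t \<longleftrightarrow>
           f (forward_jump J t) - f t = (forward_jump J t - t) *\<^sub>R \<gamma>"
proof
  assume R: "f (forward_jump J t) - f t = (forward_jump J t - t) *\<^sub>R \<gamma>"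
  show "has_delta_derivative J f \<gamma> t"
    unfolding has_delta_derivative_def
  proof (intro allI impI)
    fix \<epsilon> :: real assume "\<epsilon> > 0"
    have "s = t" if "s \<in> {..<forward_jump J t} \<inter> J" for s
      using that J forward_jump_le[of s J t] by fastforce
    then have "\<forall>s \<in> {..<forward_jump J t} \<inter> J.
           norm (f (forward_jump J t) - f s - (forward_jump J t - s) *\<^sub>R \<gamma>)
             \<le> \<epsilon> * \<bar>forward_jump J t - s\<bar>"
      using R \<open>\<epsilon> > 0\<close>
      by (metis abs_ge_zero cancel_comm_monoid_add_class.diff_cancel less_imp_le
          mult_nonneg_nonneg norm_zero)
    then show "\<exists>W. open W \<and> t \<in> W \<and> (\<forall>s \<in> W \<inter> J.
           norm (f (forward_jump J t) - f s - (forward_jump J t - s) *\<^sub>R \<gamma>)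
             \<le> \<epsilon> * \<bar>forward_jump J t - s\<bar>)"
      using sc by (intro exI[of _ "{..<forward_jump J t}"]) auto
  qed
next
  assume L: "has_delta_derivative J f \<gamma> t"
  define z where "z = norm (f (forward_jump J t) - f t - (forward_jump J t - t) *\<^sub>R \<gamma>)"
  define m where "m = forward_jump J t - t"
  have m: "m > 0" using sc by (simp add: m_def)
  have le: "z \<le> \<epsilon> * m" if pos: "\<epsilon> > 0" for \<epsilon>
  proof -
    obtain W where "t \<in> W" "\<forall>s \<in> W \<inter> J.
           norm (f (forward_jump J t) - f s - (forward_jump J t - s) *\<^sub>R \<gamma>)
             \<le> \<epsilon> * \<bar>forward_jump J t - s\<bar>"
      using L pos unfolding has_delta_derivative_def by blast
    then have "z \<le> \<epsilon> * \<bar>m\<bar>" using J(2) unfolding z_def m_def by blast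
    then show ?thesis using m by simp
  qed
  have "z \<le> 0 + e" if "e > 0" for e
    using le[of "e / m"] that m by simp
  then have "z \<le> 0" by (rule field_le_epsilon)
  then show "f (forward_jump J t) - f t = (forward_jump J t - t) *\<^sub>R \<gamma>"
    by (simp add: z_def)
qed

lemma has_delta_derivative_dense:
  assumes "forward_jump J t = t"
  shows "has_delta_derivative J f \<gamma> t \<longleftrightarrow> (f has_vector_derivative \<gamma>) (at t within J)"
proof -
  have *: "norm (f t - f s - (t - s) *\<^sub>R \<gamma>) = norm (f s - f t - (s - t) *\<^sub>R \<gamma>)" for s
    by (metis (no_types, lifting) minus_diff_eq minus_diff_minus norm_minus_cancel
        scaleR_minus_left)
  show ?thesis
  proof
    assume L: "has_delta_derivative J f \<gamma> t"
    show "(f has_vector_derivative \<gamma>) (at t within J)"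
      unfolding has_vector_derivative_def has_derivative_within_alt
    proof (intro conjI allI impI)
      show "bounded_linear (\<lambda>x. x *\<^sub>R \<gamma>)" by (rule bounded_linear_scaleR_left)
      fix e :: real assume "e > 0"
      then obtain W where W: "open W" "t \<in> W"
        "\<forall>s \<in> W \<inter> J. norm (f t - f s - (t - s) *\<^sub>R \<gamma>) \<le> e * \<bar>t - s\<bar>"
        using L unfolding has_delta_derivative_def assms by blast
      obtain d where d: "d > 0" "ball t d \<subseteq> W" using W openE by blast
      show "\<exists>d>0. \<forall>y\<in>J. norm (y - t) < d \<longrightarrow>
              norm (f y - f t - (y - t) *\<^sub>R \<gamma>) \<le> e * norm (y - t)"
      proof (intro exI[of _ d] conjI ballI impI)
        fix y assume y: "y \<in> J" "norm (y - t) < d"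
        then have "y \<in> W \<inter> J" using d by (auto simp: dist_norm norm_minus_commute)
        then show "norm (f y - f t - (y - t) *\<^sub>R \<gamma>) \<le> e * norm (y - t)"
          using W(3) unfolding * real_norm_def abs_minus_commute[of t] by blast
      qed (use d in auto)
    qed
  next
    assume R: "(f has_vector_derivative \<gamma>) (at t within J)"
    show "has_delta_derivative J f \<gamma> t"
      unfolding has_delta_derivative_def assms
    proof (intro allI impI)
      fix e :: real assume "e > 0"
      then obtain d where d: "d > 0" "\<forall>y\<in>J. norm (y - t) < d \<longrightarrow>
              norm (f y - f t - (y - t) *\<^sub>R \<gamma>) \<le> e * norm (y - t)"
        using R unfolding has_vector_derivative_def has_derivative_within_alt by blast
      show "\<exists>W. open W \<and> t \<in> W \<and>
              (\<forall>s \<in> W \<inter> J. norm (f t - f s - (t - s) *\<^sub>R \<gamma>) \<le> e * \<bar>t - s\<bar>)"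
        unfolding * using d by (intro exI[of _ "ball t d"])
          (auto simp: dist_norm norm_minus_commute abs_minus_commute)
    qed
  qed
qed

lemma solution_on_start:
  assumes s: "solution_on F (T \<inter> {t..t1}) y" and t: "t \<in> T" "t1 \<in> T" "t < t1"
  shows "has_delta_derivative (T \<inter> {t..t1}) y (F t (y t)) t"
proof -
  have "t \<in> T \<inter> {t..t1}" "\<exists>s \<in> T \<inter> {t..t1}. s > t"
    using t by (auto intro: bexI[of _ t1])
  then show ?thesis using s unfolding solution_on_def by blast
qed

lemma trajectory_derivative_scattered_iff:
  assumes T: "closed T" "t' \<in> T" "t < t'" and t: "t \<in> right_scattered T" and x: "x \<in> ball 0 r"
  shows "(\<exists>\<gamma>. has_trajectory_derivative T F r V \<gamma> t x \<and> \<gamma> \<ge> c) \<longleftrightarrow>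
         (x + graininess T t *\<^sub>R F t x \<in> ball 0 r \<longrightarrow>
            V (forward_jump T t) (x + graininess T t *\<^sub>R F t x) - V t x \<ge> graininess T t * c)"
    (is "?L \<longleftrightarrow> ?R")
proof -
  let ?s = "forward_jump T t" let ?m = "graininess T t"
  let ?x' = "x + ?m *\<^sub>R F t x"
  have tT: "t \<in> T" and ts: "t < ?s" using t by (auto simp: right_scattered_def)
  have m: "?m > 0" using ts by (simp add: graininess_def)
  have sT: "?s \<in> T" by (rule forward_jump_in) (use T in auto)
  have fj: "forward_jump (T \<inter> {t..t1}) t = ?s" if "t1 \<in> T" "t < t1" for t1
    by (rule forward_jump_restrict[OF that]) auto
  have dd: "has_delta_derivative (T \<inter> {t..t1}) f \<gamma> t \<longleftrightarrow> f ?s - f t = ?m *\<^sub>R \<gamma>"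
    if "t1 \<in> T" "t < t1" for t1 \<gamma> and f :: "real \<Rightarrow> 'b::real_normed_vector"
  proof -
    have a: "T \<inter> {t..t1} \<subseteq> {t..}" and b: "t \<in> T \<inter> {t..t1}" using tT that by auto
    show ?thesis
      using has_delta_derivative_scattered[OF a b, of f \<gamma>] ts
      by (simp add: fj[OF that] graininess_def)
  qed
  have step: "y ?s = ?x'"
    if "t1 \<in> T" "t < t1" "solution_on F (T \<inter> {t..t1}) y" "y t = x" for t1 y
  proof -
    have "has_delta_derivative (T \<inter> {t..t1}) y (F t (y t)) t"
      by (rule solution_on_start) (use that tT in auto)
    then have "y ?s - y t = ?m *\<^sub>R F t (y t)" using dd that by blast
    then show ?thesis using that by (simp add: algebra_simps)
  qed
  show ?thesis
  proof
    assume ?L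
    then obtain \<gamma> where g: "has_trajectory_derivative T F r V \<gamma> t x" "\<gamma> \<ge> c" by blast
    show ?R
    proof
      assume x': "?x' \<in> ball 0 r"
      define y where "y s = (if s = t then x else ?x')" for s
      have J: "T \<inter> {t..?s} = {t, ?s}"
        using tT sT ts forward_jump_le[of _ T t] by fastforce
      have yt: "y t = x" and ys: "y ?s = ?x'" using ts by (auto simp: y_def)
      have "has_delta_derivative (T \<inter> {t..?s}) y (F t (y t)) t"
        using dd[OF sT ts, of y "F t (y t)"] yt ys by simp
      then have sol: "solution_on F (T \<inter> {t..?s}) y"
        unfolding solution_on_def J using ts by (auto intro: continuous_on_finite)
      have "has_delta_derivative (T \<inter> {t..?s}) (\<lambda>s. V s (y s)) \<gamma> t"
        using g(1) sT ts sol yt x x' ys J unfolding has_trajectory_derivative_def by auto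
      then have "V ?s ?x' - V t x = ?m * \<gamma>"
        using dd[OF sT ts, of "\<lambda>s. V s (y s)" \<gamma>] yt ys by simp
      then show "V ?s ?x' - V t x \<ge> ?m * c" using g(2) m by simp
    qed
  next
    assume R: ?R
    show ?L
    proof (cases "?x' \<in> ball 0 r")
      case True
      let ?g = "(V ?s ?x' - V t x) / ?m"
      have "has_trajectory_derivative T F r V ?g t x"
        unfolding has_trajectory_derivative_def
      proof (intro ballI allI impI, elim conjE)
        fix t1 y
        assume a: "t1 \<in> T" "t < t1" "solution_on F (T \<inter> {t..t1}) y" "y t = x"
        show "has_delta_derivative (T \<inter> {t..t1}) (\<lambda>s. V s (y s)) ?g t"
          unfolding dd[OF a(1,2)] step[OF a] a(4) using m by simp
      qed
      moreover have "?g \<ge> c" using R True m by (simp add: field_simps)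
      ultimately show ?thesis by blast
    next
      case False
      have "has_trajectory_derivative T F r V c t x"
        unfolding has_trajectory_derivative_def
      proof (intro ballI allI impI, elim conjE)
        fix t1 y
        assume a: "t1 \<in> T" "t < t1" "solution_on F (T \<inter> {t..t1}) y" "y t = x"
          "\<forall>s\<in>T \<inter> {t..t1}. y s \<in> ball 0 r"
        have "?s \<in> T \<inter> {t..t1}" using sT ts forward_jump_le[OF a(1,2)] by auto
        then have "?x' \<in> ball 0 r" using a step[OF a(1-4)] by metis
        then show "has_delta_derivative (T \<inter> {t..t1}) (\<lambda>s. V s (y s)) c t" using False by simp
      qed
      then show ?thesis by auto
    qed
  qed
qed

text \<open>
  At a right-dense point \<open>t\<close> the trajectory derivative is
  \<open>\<partial>V/\<partial>t + \<partial>V/\<partial>x \<cdot> F\<close> as soon as \<open>V\<close> is differentiable at \<open>(t, x)\<close>; the time variable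
  ranges over \<open>T\<close> only.
\<close>

lemma trajectory_derivative_dense:
  fixes V :: "real \<Rightarrow> 'a::real_inner \<Rightarrow> real"
  assumes t: "t \<in> right_dense T" "0 \<le> t"
    and V: "((\<lambda>(s, z). V s z) has_derivative (\<lambda>(s, h). s * Vt + Vx \<bullet> h))
              (at (t, x) within (T \<inter> {0..}) \<times> ball 0 r)"
  shows "has_trajectory_derivative T F r V (Vt + Vx \<bullet> F t x) t x"
  unfolding has_trajectory_derivative_def
proof (intro ballI allI impI, elim conjE)
  fix t1 y
  let ?J = "T \<inter> {t..t1}"
  assume a: "t1 \<in> T" "t < t1" "solution_on F ?J y" "y t = x" "\<forall>s\<in>?J. y s \<in> ball 0 r"
  have tT: "t \<in> T" using t by (simp add: right_dense_def)
  have fj: "forward_jump ?J t = t"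
    using forward_jump_restrict[of t1 T t ?J] a t by (auto simp: right_dense_def)
  have "has_delta_derivative ?J y (F t x) t"
    using solution_on_start[OF a(3) tT a(1,2)] a(4) by simp
  then have "(y has_derivative (\<lambda>s. s *\<^sub>R F t x)) (at t within ?J)"
    by (simp add: has_delta_derivative_dense[OF fj] has_vector_derivative_def)
  then have p: "((\<lambda>s. (s, y s)) has_derivative (\<lambda>s. (s, s *\<^sub>R F t x))) (at t within ?J)"
    by (intro has_derivative_Pair has_derivative_ident)
  have "((\<lambda>(s, z). V s z) has_derivative (\<lambda>(s, h). s * Vt + Vx \<bullet> h))
          (at (t, y t) within (\<lambda>s. (s, y s)) ` ?J)"
  proof -
    have "(\<lambda>s. (s, y s)) ` ?J \<subseteq> (T \<inter> {0..}) \<times> ball 0 r" using a(5) t(2) by auto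
    then show ?thesis using has_derivative_subset[OF V] a(4) by simp
  qed
  from diff_chain_within[OF p this]
  have "((\<lambda>s. V s (y s)) has_derivative (\<lambda>s. s * Vt + Vx \<bullet> (s *\<^sub>R F t x))) (at t within ?J)"
    by (simp add: o_def)
  also have "(\<lambda>s. s * Vt + Vx \<bullet> (s *\<^sub>R F t x)) = (\<lambda>s. s *\<^sub>R (Vt + Vx \<bullet> F t x))"
    by (simp add: algebra_simps)
  finally show "has_delta_derivative ?J (\<lambda>s. V s (y s)) (Vt + Vx \<bullet> F t x) t"
    by (simp add: has_delta_derivative_dense[OF fj] has_vector_derivative_def)
qed

lemma right_dense_islimpt:
  assumes "t \<in> right_dense T" "t1 \<in> T" "t < t1"
  shows "t islimpt (T \<inter> {t..t1})"
  unfolding islimpt_approachable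
proof (intro allI impI)
  fix e :: real assume "e > 0"
  have "Inf {s \<in> T. s > t} < t + e"
    using assms \<open>e > 0\<close> by (simp add: right_dense_def forward_jump_def)
  then obtain s where "s \<in> T" "s > t" "s < t + e"
    using assms by (subst (asm) cInf_less_iff) (auto intro!: bdd_belowI[of _ t])
  then have "min s t1 \<in> T \<inter> {t..t1}" "min s t1 \<noteq> t" "dist (min s t1) t < e"
    using assms by (auto simp: dist_real_def right_dense_def min_def)
  then show "\<exists>s\<in>T \<inter> {t..t1}. s \<noteq> t \<and> dist s t < e" by blast
qed

lemma solution_on_restrict:
  assumes s: "solution_on F J x" and J: "T \<inter> {t..t1} \<subseteq> J" "J \<subseteq> T \<inter> {t..}" and t1: "t1 \<in> T"
  shows "solution_on F (T \<inter> {t..t1}) x"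
  unfolding solution_on_def
proof (intro conjI ballI impI)
  show "continuous_on (T \<inter> {t..t1}) x"
    using s J continuous_on_subset unfolding solution_on_def by blast
  fix u assume u: "u \<in> T \<inter> {t..t1}" "\<exists>s\<in>T \<inter> {t..t1}. u < s"
  have ut: "u < t1" using u by auto
  have "u \<in> J" "t1 \<in> J" using u J t1 by auto
  then have d: "has_delta_derivative J x (F u (x u)) u"
    using s ut unfolding solution_on_def by blast
  have "forward_jump (T \<inter> {t..t1}) u = forward_jump T u"
    by (rule forward_jump_restrict[OF t1 ut]) (use u in auto)
  moreover have "forward_jump J u = forward_jump T u"
    by (rule forward_jump_restrict[OF t1 ut]) (use u J in auto)
  ultimately have fj: "forward_jump (T \<inter> {t..t1}) u = forward_jump J u" by simp
  show "has_delta_derivative (T \<inter> {t..t1}) x (F u (x u)) u"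
    unfolding has_delta_derivative_def fj
  proof (intro allI impI)
    fix e :: real assume "e > 0"
    then obtain W where "open W" "u \<in> W" "\<forall>s \<in> W \<inter> J.
        norm (x (forward_jump J u) - x s - (forward_jump J u - s) *\<^sub>R F u (x u))
          \<le> e * \<bar>forward_jump J u - s\<bar>"
      using d unfolding has_delta_derivative_def by blast
    then show "\<exists>W. open W \<and> u \<in> W \<and> (\<forall>s \<in> W \<inter> (T \<inter> {t..t1}).
        norm (x (forward_jump J u) - x s - (forward_jump J u - s) *\<^sub>R F u (x u))
          \<le> e * \<bar>forward_jump J u - s\<bar>)"
      using J(1) by blast
  qed
qed

lemma trajectory_derivative_dense_iff:
  fixes V :: "real \<Rightarrow> 'a::real_inner \<Rightarrow> real"
  assumes T: "time_scale T" "\<not> bdd_above (right_scattered T)"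
    and F: "uniquely_solvable_in T F (ball 0 r)"
    and t: "t \<in> right_dense T" "0 \<le> t" and x: "x \<in> ball 0 r"
    and V: "((\<lambda>(s, z). V s z) has_derivative (\<lambda>(s, h). s * Vt + Vx \<bullet> h))
              (at (t, x) within (T \<inter> {0..}) \<times> ball 0 r)"
  shows "(\<exists>\<gamma>. has_trajectory_derivative T F r V \<gamma> t x \<and> \<gamma> \<ge> c) \<longleftrightarrow> Vt + Vx \<bullet> F t x \<ge> c"
proof
  let ?B = "ball (0::'a) r"
  assume "\<exists>\<gamma>. has_trajectory_derivative T F r V \<gamma> t x \<and> \<gamma> \<ge> c"
  then obtain \<gamma> where g: "has_trajectory_derivative T F r V \<gamma> t x" "\<gamma> \<ge> c" by blast
  have tT: "t \<in> T" using t by (simp add: right_dense_def)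
  have "\<exists>t1 \<in> T. t < t1 \<and> (\<exists>y. solution_on F (T \<inter> {t..t1}) y \<and> y t = x \<and>
                              (\<forall>s \<in> T \<inter> {t..t1}. y s \<in> ?B))"
  proof -
    have "t \<in> T \<inter> {0..}" using tT t(2) by simp
    with F x have "(\<exists>y. solution_on F (T \<inter> {t..}) y \<and> y t = x \<and> (\<forall>s \<in> T \<inter> {t..}. y s \<in> ?B)) \<or>
        (\<exists>t2 \<in> T. t < t2 \<and> (\<exists>y. solution_on F (T \<inter> {t..t2}) y \<and> y t = x \<and>
                (\<forall>s \<in> T \<inter> {t..<t2}. y s \<in> ?B) \<and> y t2 \<notin> ?B))"
      unfolding uniquely_solvable_in_def by blast
    then consider
      (global) y where "solution_on F (T \<inter> {t..}) y" "y t = x" "\<forall>s \<in> T \<inter> {t..}. y s \<in> ?B"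
    | (exit) t2 y where "t2 \<in> T" "t < t2" "solution_on F (T \<inter> {t..t2}) y" "y t = x"
        "\<forall>s \<in> T \<inter> {t..<t2}. y s \<in> ?B"
      by blast
    then show ?thesis
    proof cases
      case global
      obtain t1 where "t1 \<in> right_scattered T" "t < t1"
        using T(2) unfolding bdd_above_def by (meson not_le)
      then have t1: "t1 \<in> T" "t < t1" by (auto simp: right_scattered_def)
      have "solution_on F (T \<inter> {t..t1}) y"
        by (rule solution_on_restrict[OF global(1) _ _ t1(1)]) auto
      then show ?thesis using t1 global by (intro bexI[of _ t1]) auto
    next
      case exit
      obtain t1 where t1: "t1 \<in> T" "t < t1" "t1 < t2"
      proof -
        have "t2 - t > 0" using exit by simp
        then obtain s where "s \<in> T \<inter> {t..t2}" "s \<noteq> t" "dist s t < t2 - t"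
          using right_dense_islimpt[OF t(1) exit(1,2)] unfolding islimpt_approachable by blast
        then show thesis using that[of s] by (auto simp: dist_real_def)
      qed
      have "solution_on F (T \<inter> {t..t1}) y"
        by (rule solution_on_restrict[OF exit(3) _ _ t1(1)]) (use t1 in auto)
      then show ?thesis using t1 exit by (intro bexI[of _ t1]) auto
    qed
  qed
  then obtain t1 y where y: "t1 \<in> T" "t < t1" "solution_on F (T \<inter> {t..t1}) y" "y t = x"
    "\<forall>s \<in> T \<inter> {t..t1}. y s \<in> ?B" by blast
  have fj: "forward_jump (T \<inter> {t..t1}) t = t"
    using forward_jump_restrict[of t1 T t "T \<inter> {t..t1}"] y t by (auto simp: right_dense_def)
  have 1: "has_delta_derivative (T \<inter> {t..t1}) (\<lambda>s. V s (y s)) \<gamma> t"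
    using g(1) y unfolding has_trajectory_derivative_def by blast
  have 2: "has_delta_derivative (T \<inter> {t..t1}) (\<lambda>s. V s (y s)) (Vt + Vx \<bullet> F t x) t"
    using trajectory_derivative_dense[OF t V] y unfolding has_trajectory_derivative_def by blast
  have "at t within (T \<inter> {t..t1}) \<noteq> bot"
    using right_dense_islimpt[OF t(1) y(1,2)] by (simp add: trivial_limit_within)
  then have "\<gamma> = Vt + Vx \<bullet> F t x"
    using 1 2 unfolding has_delta_derivative_dense[OF fj]
    by (rule vector_derivative_unique_within)
  then show "Vt + Vx \<bullet> F t x \<ge> c" using g(2) by simp
next
  assume "Vt + Vx \<bullet> F t x \<ge> c"
  then show "\<exists>\<gamma>. has_trajectory_derivative T F r V \<gamma> t x \<and> \<gamma> \<ge> c"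
    using trajectory_derivative_dense[OF t V] by blast
qed

end

(* If the zero solution were stable, a solution starting close to 0 in the set where V > 0 would
   stay so close to 0 that V remains bounded along it. But V increases along it, so by uniform
   continuity at 0 the solution keeps away from 0, and there w has a positive lower bound. Hence V
   grows at least linearly along the solution, a contradiction. *)

theory Submission
  imports Defs
begin

text \<open>The supremum of the points up to which \<open>P\<close> holds throughout is again such a
  point, and \<open>step\<close> would carry \<open>P\<close> past it unless it is
  \<open>t1\<close>. Closedness handles the limit from the left; the single hypothesis
  \<open>step\<close> covers both right-scattered and right-dense points.\<close>

lemma time_scale_induct:
  fixes T :: "real set"
  assumes T: "closed T" "t0 \<in> T" "t1 \<in> T" "t0 \<le> t1"
    and clo: "closed {t \<in> T \<inter> {t0..t1}. P t}"
    and base: "P t0"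
    and step: "\<And>t. t \<in> T \<inter> {t0..<t1} \<Longrightarrow> P t \<Longrightarrow>
                 \<exists>s \<in> T \<inter> {t<..t1}. \<forall>u \<in> T \<inter> {t<..s}. P u"
  shows "P t1"
proof -
  define S where "S = {t \<in> T \<inter> {t0..t1}. \<forall>u \<in> T \<inter> {t0..t}. P u}"
  define m where "m = Sup S"
  have t0S: "t0 \<in> S" using T base by (auto simp: S_def)
  have bS: "bdd_above S" by (rule bdd_aboveI[of _ t1]) (auto simp: S_def)
  have "m \<in> closure S"
    unfolding m_def by (rule closure_contains_Sup) (use t0S bS in auto)
  \<comment> \<open>\<open>S\<close> is not yet known to be closed, so this gives \<open>P m\<close>
    only; the points below \<open>m\<close> are treated separately.\<close>
  also have "closure S \<subseteq> {t \<in> T \<inter> {t0..t1}. P t}"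
    by (rule closure_minimal[OF _ clo]) (auto simp: S_def)
  finally have m: "m \<in> T" "t0 \<le> m" "m \<le> t1" "P m" by auto
  have below: "P u" if "u \<in> T" "t0 \<le> u" "u < m" for u
  proof -
    obtain s where "s \<in> S" "u < s"
      using less_cSup_iff[of S u] t0S bS \<open>u < m\<close> unfolding m_def by blast
    then show ?thesis using that by (auto simp: S_def)
  qed
  have upto: "P u" if "u \<in> T" "t0 \<le> u" "u \<le> m" for u
    using below[of u] m that by (cases "u = m") auto
  have "m = t1"
  proof (rule ccontr)
    assume "m \<noteq> t1"
    then obtain s where s: "s \<in> T" "m < s" "s \<le> t1" "\<forall>u \<in> T \<inter> {m<..s}. P u"
      using step[of m] m by auto
    have "P u" if "u \<in> T" "t0 \<le> u" "u \<le> s" for u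
      using upto[of u] s(4) that by (cases "u \<le> m") auto
    then have "s \<in> S" using s m by (auto simp: S_def)
    then have "s \<le> m" unfolding m_def by (rule cSup_upper[OF _ bS])
    then show False using s by simp
  qed
  then show ?thesis using m by simp
qed

text \<open>The strict inequality \<gamma> > k leaves the slack that absorbs the error term at
  right-dense points. The derivative is demanded only where the bound already holds, because the
  Chetaev condition is available only where V is positive.\<close>

lemma delta_derivative_linear_growth:
  fixes f :: "real \<Rightarrow> real"
  assumes T: "closed T" "t0 \<in> T" "t1 \<in> T" "t0 \<le> t1"
    and cont: "continuous_on (T \<inter> {t0..t1}) f"
    and deriv: "\<And>t. t \<in> T \<inter> {t0..<t1} \<Longrightarrow> f t \<ge> f t0 + k * (t - t0) \<Longrightarrow>
                  \<exists>\<gamma>>k. has_delta_derivative (T \<inter> {t..t1}) f \<gamma> t"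
  shows "f t1 \<ge> f t0 + k * (t1 - t0)"
proof (rule time_scale_induct[OF T, where P = "\<lambda>t. f t \<ge> f t0 + k * (t - t0)"])
  show "closed {t \<in> T \<inter> {t0..t1}. f t \<ge> f t0 + k * (t - t0)}"
  proof -
    have "closed (T \<inter> {t0..t1} \<inter> (\<lambda>t. f t - (f t0 + k * (t - t0))) -` {0..})"
      using T cont by (intro continuous_closed_preimage) (auto intro!: continuous_intros)
    then show ?thesis by (rule back_subst[of closed]) auto
  qed
next
  fix t assume t: "t \<in> T \<inter> {t0..<t1}" and ft: "f t0 + k * (t - t0) \<le> f t"
  let ?J = "T \<inter> {t..t1}" let ?s = "forward_jump T t"
  have tT: "t \<in> T" "t < t1" using t by auto
  have fj: "forward_jump ?J t = ?s"
    by (rule forward_jump_restrict[OF T(3) tT(2)]) auto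
  obtain \<gamma> where g: "\<gamma> > k" "has_delta_derivative ?J f \<gamma> t"
    using deriv[OF t ft] by blast
  have grow: "f t0 + k * (u - t0) \<le> f u" if "k * (u - t) \<le> f u - f t" for u
    using that ft by (simp add: algebra_simps)
  have "t \<le> ?s"
    unfolding forward_jump_def by (rule cInf_greatest) (use T tT in auto)
  then consider "t < ?s" | "t = ?s" by linarith
  then show "\<exists>s \<in> T \<inter> {t<..t1}. \<forall>u \<in> T \<inter> {t<..s}. f t0 + k * (u - t0) \<le> f u"
  proof cases
    \<comment> \<open>At a right-scattered point the derivative is the exact difference quotient
      over the jump, and the jump point is the only point of \<open>T\<close> to be checked.\<close>
    case 1
    have "f ?s - f t = (?s - t) * \<gamma>"
      using has_delta_derivative_scattered[of ?J t f \<gamma>, OF Int_lower2[THEN order_trans]] g tT 1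
      by (simp add: fj)
    moreover have "(?s - t) * k \<le> (?s - t) * \<gamma>"
      using g 1 by (intro mult_left_mono) auto
    ultimately have "f t0 + k * (?s - t0) \<le> f ?s"
      by (intro grow) (simp add: mult.commute)
    then have "f t0 + k * (u - t0) \<le> f u" if "u \<in> T" "t < u" "u \<le> ?s" for u
      using forward_jump_le[OF that(1,2)] that(3) by (simp add: order_antisym)
    then show ?thesis
      using 1 forward_jump_in[OF T(1,3) tT(2)] forward_jump_le[OF T(3) tT(2)]
      by (intro bexI[of _ ?s]) auto
  next
    case 2
    \<comment> \<open>With tolerance \<open>\<gamma> - k\<close> the increment over
      \<open>u - t\<close> is still at least \<open>k * (u - t)\<close>.\<close>
    obtain W where W: "open W" "t \<in> W"
      "\<forall>s \<in> W \<inter> ?J. norm (f t - f s - (t - s) *\<^sub>R \<gamma>) \<le> (\<gamma> - k) * \<bar>t - s\<bar>"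
      using g unfolding has_delta_derivative_def fj 2[symmetric] by (meson diff_gt_0_iff_gt)
    obtain d where d: "d > 0" "ball t d \<subseteq> W" using W openE by blast
    have "t \<in> right_dense T" using 2 tT by (simp add: right_dense_def)
    then obtain s where s: "s \<in> ?J" "s \<noteq> t" "dist s t < d"
      using right_dense_islimpt[of t T t1] T tT d unfolding islimpt_approachable by blast
    have "f t0 + k * (u - t0) \<le> f u" if u: "u \<in> T \<inter> {t<..s}" for u
    proof (rule grow)
      have "u \<in> W \<inter> ?J" using u s d by (auto simp: dist_real_def subset_iff)
      then have "norm (f t - f u - (t - u) *\<^sub>R \<gamma>) \<le> (\<gamma> - k) * \<bar>t - u\<bar>"
        using W(3) by blast
      then have "\<bar>f t - f u - (t - u) * \<gamma>\<bar> \<le> (\<gamma> - k) * (u - t)"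
        using u by simp
      then show "k * (u - t) \<le> f u - f t"
        by (simp add: algebra_simps abs_le_iff)
    qed
    then show ?thesis using s by (intro bexI[of _ s]) auto
  qed
qed simp

lemma has_delta_derivative_subset:
  assumes "has_delta_derivative J f \<gamma> t" "J' \<subseteq> J" "forward_jump J' t = forward_jump J t"
  shows "has_delta_derivative J' f \<gamma> t"
  using assms unfolding has_delta_derivative_def by (metis IntE IntI subsetD)

text \<open>Makes a global solution, followed from a later time \<open>t\<close>, admissible as a
  test solution in \<open>has_trajectory_derivative\<close>. Forward jumps before \<open>t1\<close>
  survive the restriction because \<open>t1\<close> stays in the set.\<close>

lemma solution_on_subinterval:
  assumes s: "solution_on F (T \<inter> {t0..}) x" and t: "t0 \<le> t" "t1 \<in> T"
  shows "solution_on F (T \<inter> {t..t1}) x"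
  unfolding solution_on_def
proof (intro conjI ballI impI)
  have sub: "T \<inter> {t..t1} \<subseteq> T \<inter> {t0..}" using t by auto
  show "continuous_on (T \<inter> {t..t1}) x"
    using s sub continuous_on_subset unfolding solution_on_def by blast
  fix u assume u: "u \<in> T \<inter> {t..t1}" "\<exists>s\<in>T \<inter> {t..t1}. u < s"
  have ut: "u < t1" using u by auto
  have "t1 \<in> T \<inter> {t0..}" using t ut u by auto
  then have d: "has_delta_derivative (T \<inter> {t0..}) x (F u (x u)) u"
    using s ut u sub unfolding solution_on_def by blast
  have "forward_jump (T \<inter> {t..t1}) u = forward_jump T u"
    "forward_jump (T \<inter> {t0..}) u = forward_jump T u"
    by (rule forward_jump_restrict[OF t(2) ut]; use u t in auto)+
  then show "has_delta_derivative (T \<inter> {t..t1}) x (F u (x u)) u"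
    by (intro has_delta_derivative_subset[OF d sub]) simp
qed

text \<open>The positivity domain is open, so it does not contain its frontier point 0; a negative
  value at 0 would give a neighbourhood of 0 disjoint from the domain.\<close>

lemma vanishes_at_frontier_positivity_domain:
  assumes cont: "continuous_on (ball 0 r) (V t)" and r: "r > 0"
    and fr: "0 \<in> frontier (positivity_domain r V t)"
  shows "V t 0 = 0"
proof -
  have op: "open (positivity_domain r V t)"
  proof -
    have "open (ball 0 r \<inter> V t -` {0<..})"
      by (rule continuous_open_preimage[OF cont]) auto
    also have "ball 0 r \<inter> V t -` {0<..} = positivity_domain r V t"
      by (auto simp: positivity_domain_def)
    finally show ?thesis .
  qed
  have not0: "0 \<notin> positivity_domain r V t"
    using fr op by (simp add: frontier_def interior_open)
  then have "V t 0 \<le> 0" using r by (simp add: positivity_domain_def)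
  moreover have "V t 0 \<ge> 0"
  proof (rule ccontr)
    assume "\<not> V t 0 \<ge> 0"
    then have "open (ball 0 r \<inter> V t -` {..<0}) \<and> 0 \<in> ball 0 r \<inter> V t -` {..<0}"
      using continuous_open_preimage[OF cont, of "{..<0}"] r by auto
    moreover have "(ball 0 r \<inter> V t -` {..<0}) \<inter> positivity_domain r V t = {}"
      by (auto simp: positivity_domain_def)
    ultimately show False
      using fr open_Int_closure_eq_empty unfolding frontier_def by blast
  qed
  ultimately show ?thesis by simp
qed

lemma chetaev_function_unstable:
  fixes F :: "real \<Rightarrow> 'a::{real_normed_vector, heine_borel} \<Rightarrow> 'a"
  assumes T: "closed T" "\<not> bdd_above T" and r: "r > 0"
    and chet: "chetaev_function T F r V"
  shows "zero_solution_unstable T F"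
proof
  assume stable: "zero_solution_stable T F"
  obtain a w where cont: "continuous_on ((T \<inter> {0..}) \<times> ball 0 r) (\<lambda>(t, x). V t x)"
    and a: "a > 0"
    and fr: "\<And>t. t \<in> T \<Longrightarrow> a \<le> t \<Longrightarrow> 0 \<in> frontier (positivity_domain r V t)"
    and unif: "\<And>\<epsilon>. \<epsilon> > 0 \<Longrightarrow> \<exists>\<delta>>0. \<forall>t \<in> T \<inter> {a..}. \<forall>x \<in> ball 0 r.
           norm x < \<delta> \<longrightarrow> \<bar>V t x - V t 0\<bar> < \<epsilon>"
    and w: "positive_definite_on (ball 0 r) w"
    and Vder: "\<And>t x. t \<in> T \<Longrightarrow> a \<le> t \<Longrightarrow> x \<in> positivity_domain r V t \<Longrightarrow>
              \<exists>\<gamma>. has_trajectory_derivative T F r V \<gamma> t x \<and> \<gamma> \<ge> w x"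
    using chet unfolding chetaev_function_def by auto
  have V0: "V t 0 = 0" if t: "t \<in> T" "a \<le> t" for t
  proof (rule vanishes_at_frontier_positivity_domain[OF _ r fr[OF t]])
    have "continuous_on (ball 0 r) (\<lambda>x. (\<lambda>(t, x). V t x) (t, x))"
      by (rule continuous_on_compose2[OF cont]) (use a t in \<open>auto intro!: continuous_intros\<close>)
    then show "continuous_on (ball 0 r) (V t)" by simp
  qed
  \<comment> \<open>Since V vanishes at the origin, uniform continuity there becomes uniform
    smallness of V itself.\<close>
  have small: "\<exists>\<delta>>0. \<forall>t x. t \<in> T \<longrightarrow> a \<le> t \<longrightarrow> norm x < r \<longrightarrow> norm x < \<delta> \<longrightarrow> \<bar>V t x\<bar> < \<epsilon>"
    if "\<epsilon> > 0" for \<epsilon>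
    using unif[OF that] V0 by (auto simp: dist_norm)
  obtain t0 where t0: "t0 \<in> T" "a \<le> t0" using T(2) unfolding bdd_above_def by (meson nle_le)
  obtain d where d: "d > 0"
    "\<And>t x. t \<in> T \<Longrightarrow> a \<le> t \<Longrightarrow> norm x < r \<Longrightarrow> norm x < d \<Longrightarrow> \<bar>V t x\<bar> < 1"
    using small[of 1] by auto
  \<comment> \<open>The bound \<open>d\<close> forces |V| < 1 on the ball of radius
    \<open>e\<close>; \<open>r / 2\<close> keeps the closed ball inside the open ball of radius
    \<open>r\<close>.\<close>
  define e where "e = min d (r / 2)"
  have e: "e > 0" "e \<le> d" "e < r" using d r by (auto simp: e_def)
  obtain \<delta> where del: "\<delta> > 0" "\<And>x0. norm x0 < \<delta> \<Longrightarrow>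
        \<exists>x. solution_on F (T \<inter> {t0..}) x \<and> x t0 = x0 \<and> (\<forall>t \<in> T \<inter> {t0..}. norm (x t) < e)"
  proof -
    have "t0 \<in> T \<inter> {0..}" using t0 a by simp
    then show thesis using that stable e(1) unfolding zero_solution_stable_def by blast
  qed
  \<comment> \<open>As a frontier point, 0 is approached by points with V > 0, so one lies within
    the stability radius.\<close>
  have "0 \<in> closure (positivity_domain r V t0)" using fr[OF t0] by (simp add: frontier_def)
  then obtain x0 where x0: "x0 \<in> positivity_domain r V t0" "norm x0 < \<delta>"
    using del(1) unfolding closure_approachable by (auto simp: dist_norm)
  obtain x where x: "solution_on F (T \<inter> {t0..}) x" "x t0 = x0"
    "\<And>t. t \<in> T \<Longrightarrow> t0 \<le> t \<Longrightarrow> norm (x t) < e"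
    using del(2)[OF x0(2)] by auto
  define v where "v t = V t (x t)" for t
  have v0: "v t0 > 0" using x0 x(2) by (simp add: v_def positivity_domain_def)
  have v_less: "v t < 1" if "t \<in> T" "t0 \<le> t" for t
    using d(2)[of t "x t"] x(3)[OF that] e t0 that by (auto simp: v_def)
  have v_cont: "continuous_on (T \<inter> {t0..}) v"
  proof -
    have "continuous_on (T \<inter> {t0..}) (\<lambda>t. (\<lambda>(t, x). V t x) (t, x t))"
    proof (rule continuous_on_compose2[OF cont])
      show "continuous_on (T \<inter> {t0..}) (\<lambda>t. (t, x t))"
        using x(1) unfolding solution_on_def by (auto intro!: continuous_intros)
      show "(\<lambda>t. (t, x t)) ` (T \<inter> {t0..}) \<subseteq> (T \<inter> {0..}) \<times> ball 0 r"
        using x(3) e t0 a by fastforce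
    qed
    then show ?thesis by (simp add: v_def[abs_def])
  qed
  \<comment> \<open>Inside radius \<eta> the values of V are below the initial value
    \<open>v t0\<close>, so the solution stays outside as long as \<open>v\<close> has not dropped
    below it.\<close>
  obtain \<eta> where eta: "\<eta> > 0"
    "\<And>t x. t \<in> T \<Longrightarrow> a \<le> t \<Longrightarrow> norm x < r \<Longrightarrow> norm x < \<eta> \<Longrightarrow> \<bar>V t x\<bar> < v t0"
    using small[OF v0] by auto
  have away: "x t \<in> cball 0 e - ball 0 \<eta>" if "t \<in> T" "t0 \<le> t" "v t0 \<le> v t" for t
    using eta(2)[of t "x t"] x(3)[of t] e t0 that by (force simp: v_def)
  \<comment> \<open>The shell is compact, contains \<open>x t0\<close> and omits 0, so
    \<open>w\<close> attains a positive minimum on it.\<close>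
  obtain c where c: "c > 0" "\<And>z. z \<in> cball 0 e - ball 0 \<eta> \<Longrightarrow> c \<le> w z"
  proof -
    let ?K = "cball 0 e - ball 0 \<eta> :: 'a set"
    have K: "?K \<subseteq> ball 0 r" using e by auto
    have "compact ?K" by (rule compact_diff) auto
    moreover have "?K \<noteq> {}" using away[of t0] t0 by auto
    moreover have "continuous_on ?K w"
      using w K continuous_on_subset unfolding positive_definite_on_def by blast
    ultimately obtain z where z: "z \<in> ?K" "\<forall>y \<in> ?K. w z \<le> w y"
      using continuous_attains_inf by blast
    moreover have "z \<noteq> 0" using z eta by auto
    ultimately show thesis
      using that[of "w z"] w K unfolding positive_definite_on_def by blast
  qed
  \<comment> \<open>Half of \<open>c\<close> is used because the growth lemma needs a derivative
    strictly above the slope.\<close>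
  have grow: "v t0 + c / 2 * (t1 - t0) \<le> v t1" if t1: "t1 \<in> T" "t0 \<le> t1" for t1
  proof (rule delta_derivative_linear_growth[OF T(1) t0(1) t1])
    show "continuous_on (T \<inter> {t0..t1}) v"
      by (rule continuous_on_subset[OF v_cont]) auto
    fix t assume t: "t \<in> T \<inter> {t0..<t1}" and le: "v t0 + c / 2 * (t - t0) \<le> v t"
    \<comment> \<open>The bound assumed at \<open>t\<close> puts \<open>x t\<close> both in the
      positivity domain and in the shell, so no circularity arises.\<close>
    have "c / 2 * (t - t0) \<ge> 0" using c t by simp
    then have vt: "v t0 \<le> v t" using le by linarith
    have xr: "x s \<in> ball 0 r" if "s \<in> T" "t0 \<le> s" for s using x(3)[OF that] e by simp
    have "x t \<in> positivity_domain r V t"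
      using vt v0 xr t by (simp add: positivity_domain_def v_def)
    then obtain \<gamma> where g: "has_trajectory_derivative T F r V \<gamma> t (x t)" "\<gamma> \<ge> w (x t)"
      using Vder[of t "x t"] t t0 by auto
    have "solution_on F (T \<inter> {t..t1}) x"
      by (rule solution_on_subinterval[OF x(1) _ t1(1)]) (use t in auto)
    then have "has_delta_derivative (T \<inter> {t..t1}) v \<gamma> t"
      using g(1) t t1 xr unfolding has_trajectory_derivative_def v_def[abs_def] by auto
    moreover have "c / 2 < \<gamma>"
      using c(2)[OF away[of t]] c(1) g(2) vt t by auto
    ultimately show "\<exists>\<gamma>>c / 2. has_delta_derivative (T \<inter> {t..t1}) v \<gamma> t" by blast
  qed
  \<comment> \<open>Beyond \<open>t0 + 2 / c\<close> the linear term alone exceeds 1, the upper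
    bound for \<open>v\<close>.\<close>
  obtain t1 where t1: "t1 \<in> T" "t1 > t0 + 2 / c"
    using T(2) unfolding bdd_above_def by (meson not_le)
  have "t0 \<le> t1" using t1 c(1) by (smt (verit) divide_pos_pos)
  moreover have "1 \<le> c / 2 * (t1 - t0)" using t1 c(1) by (simp add: field_simps)
  ultimately show False
    using grow[OF t1(1)] v_less[OF t1(1)] v0 by linarith
qed

theorem theorem7p9:
  fixes T :: "real set"
    and F :: "real \<Rightarrow> real ^ 'n \<Rightarrow> real ^ 'n"
    and V :: "real \<Rightarrow> real ^ 'n \<Rightarrow> real"
    and r :: real
  assumes "time_scale T"
    and "\<not> bdd_above (right_scattered T)"
    and "\<And>t. t \<in> T \<inter> {0..} \<Longrightarrow> F t 0 = 0"
    and "r > 0"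
    and "uniquely_solvable_in T F (ball 0 r)"
    and "chetaev_function T F r V"
  shows "zero_solution_unstable T F"
proof (rule chetaev_function_unstable)
  show "closed T" using assms(1) by (simp add: time_scale_def)
  \<comment> \<open>\<open>time_scale\<close> alone would allow \<open>T\<close> to be unbounded
    only below; the scattered points force it to be unbounded above.\<close>
  have "right_scattered T \<subseteq> T" by (auto simp: right_scattered_def)
  then show "\<not> bdd_above T" using assms(2) by (auto dest: bdd_above_mono)
qed fact+

end
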